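(* Let $a,b$ be positive integers with $a+b=5$, and let $m,s$ be positive integers. Then there exists a magic rectangle $MR(am,bm;bs,as)$ if and only if $s$ is even and $2\leq s\leq m$.
   Context: For positive integers $m,n,r,s$ with $mr=ns$, $r\le n$, $s\le m$, a magic rectangle $MR(m,n;r,s)$ is an $m\times n$ array in which some cells may be empty, each row contains exactly $r$ filled cells, each column contains exactly $s$ filled cells, the filled cells contain the numbers $0,1,\ldots,mr-1$, each exactly once, the sum of the entries of each row is the same for all rows, and the sum of the entries of each column is the same for all columns. *)

theory Defs
  imports Main
begin

text \<open>An array with \<open>m\<close> rows and \<open>n\<close> columns, some cells of which may be empty, is a function
  \<open>A :: nat \<Rightarrow> nat \<Rightarrow> nat option\<close>, read only at \<open>i < m\<close> and \<open>j < n\<close>; \<open>None\<close> marks an empty cell.\<close>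

definition filled_cells :: "nat \<Rightarrow> nat \<Rightarrow> (nat \<Rightarrow> nat \<Rightarrow> nat option) \<Rightarrow> (nat \<times> nat) set" where
  "filled_cells m n A = {(i, j). i < m \<and> j < n \<and> A i j \<noteq> None}"

definition row_cells :: "nat \<Rightarrow> (nat \<Rightarrow> nat \<Rightarrow> nat option) \<Rightarrow> nat \<Rightarrow> nat set" where
  "row_cells n A i = {j. j < n \<and> A i j \<noteq> None}"

definition col_cells :: "nat \<Rightarrow> (nat \<Rightarrow> nat \<Rightarrow> nat option) \<Rightarrow> nat \<Rightarrow> nat set" where
  "col_cells m A j = {i. i < m \<and> A i j \<noteq> None}"

definition magic_rectangle ::
  "nat \<Rightarrow> nat \<Rightarrow> nat \<Rightarrow> nat \<Rightarrow> (nat \<Rightarrow> nat \<Rightarrow> nat option) \<Rightarrow> bool" where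
  "magic_rectangle m n r s A \<longleftrightarrow>
     0 < m \<and> 0 < n \<and> 0 < r \<and> 0 < s \<and> m * r = n * s \<and> r \<le> n \<and> s \<le> m \<and>
     (\<forall>i<m. card (row_cells n A i) = r) \<and>
     (\<forall>j<n. card (col_cells m A j) = s) \<and>
     bij_betw (\<lambda>(i, j). the (A i j)) (filled_cells m n A) {0..<m * r} \<and>
     (\<exists>\<rho>. \<forall>i<m. (\<Sum>j\<in>row_cells n A i. the (A i j)) = \<rho>) \<and>
     (\<exists>\<sigma>. \<forall>j<n. (\<Sum>i\<in>col_cells m A j. the (A i j)) = \<sigma>)"

end

theory Submission
  imports Defs "HOL-Library.FuncSet"
begin

text \<open>Necessity: comparing the total of all entries with the equal row and column sums gives
  \<open>2 \<rho> = b s (N - 1)\<close> and \<open>2 \<sigma> = a s (N - 1)\<close>, where \<open>N = a b m s\<close> is even because \<open>a + b\<close> is odd.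
  Adding the two equations shows that \<open>5 s (N - 1)\<close>, and hence \<open>s\<close>, is even.

  Sufficiency: cut the array into \<open>m \<times> m\<close> blocks of size \<open>a \<times> b\<close> and fill the first \<open>s\<close> cyclic
  block diagonals. Diagonals \<open>2 t\<close> and \<open>2 t + 1\<close> carry, in each block column, a block \<open>X\<close> and its
  complement \<open>N - 1 - X\<close>. Then all column sums agree, and the row sums agree as soon as, for each
  \<open>t\<close>, the row sums of \<open>X\<close> do not depend on the block column. Such blocks are written down
  explicitly for \<open>(a, b) = (1, 4)\<close> and \<open>(2, 3)\<close>; transposition gives the other two cases.\<close>

section \<open>Transposition and the necessary condition\<close>

text \<open>Facts about rows carry over to columns this way, and a construction for
  \<open>(a, b)\<close> also serves \<open>(b, a)\<close>.\<close>

lemma magic_rectangle_transpose: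
  assumes "magic_rectangle m n r s A"
  shows "magic_rectangle n m s r (\<lambda>i j. A j i)"
proof -
  have rows: "row_cells m (\<lambda>i j. A j i) = col_cells m A"
    by (simp add: row_cells_def col_cells_def fun_eq_iff)
  have cols: "col_cells n (\<lambda>i j. A j i) = row_cells n A"
    by (simp add: row_cells_def col_cells_def fun_eq_iff)
  have total: "m * r = n * s"
    using assms by (simp add: magic_rectangle_def)
  have "bij_betw prod.swap (filled_cells n m (\<lambda>i j. A j i)) (filled_cells m n A)"
    by (rule bij_betwI[where g = prod.swap]) (auto simp: filled_cells_def)
  moreover have "bij_betw (\<lambda>(i, j). the (A i j)) (filled_cells m n A) {0..<m * r}"
    using assms unfolding magic_rectangle_def by blast
  ultimately have "bij_betw ((\<lambda>(i, j). the (A i j)) \<circ> prod.swap)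
      (filled_cells n m (\<lambda>i j. A j i)) {0..<m * r}"
    by (rule bij_betw_trans)
  moreover have "(\<lambda>(i, j). the (A i j)) \<circ> prod.swap = (\<lambda>(i, j). the (A j i))"
    by auto
  ultimately show ?thesis
    using assms unfolding magic_rectangle_def rows cols total by simp
qed

lemma filled_cells_Sigma: "filled_cells m n A = Sigma {..<m} (row_cells n A)"
  by (auto simp: filled_cells_def row_cells_def)

lemma finite_row_cells [simp]: "finite (row_cells n A i)"
  by (simp add: row_cells_def)

text \<open>Adding the common row sum \<open>\<rho>\<close> over all \<open>m\<close> rows counts
  every entry once, so \<open>m * \<rho>\<close> is the sum of the numbers below
  \<open>m * r\<close>. Cancelling \<open>m\<close> leaves
  \<open>2 * \<rho> = r * (m * r - 1)\<close>.\<close>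

lemma magic_rectangle_row_sum:
  assumes "magic_rectangle m n r s A"
  shows "even (r * (m * r - 1))"
proof -
  obtain \<rho> where \<rho>: "\<And>i. i < m \<Longrightarrow> (\<Sum>j\<in>row_cells n A i. the (A i j)) = \<rho>"
    and bij: "bij_betw (\<lambda>(i, j). the (A i j)) (filled_cells m n A) {0..<m * r}" and "0 < m"
    using assms unfolding magic_rectangle_def by blast
  have "\<Sum>{0..<m * r} = (\<Sum>(i, j)\<in>filled_cells m n A. the (A i j))"
    using sum.reindex_bij_betw[OF bij, of "\<lambda>x. x"] by (simp add: case_prod_unfold)
  also have "\<dots> = (\<Sum>i<m. \<Sum>j\<in>row_cells n A i. the (A i j))"
    unfolding filled_cells_Sigma by (simp add: sum.Sigma)
  also have "\<dots> = m * \<rho>"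
    using \<rho> by simp
  finally have "m * (2 * \<rho>) = 2 * \<Sum>{0..<m * r}"
    by simp
  also have "\<dots> = m * (r * (m * r - 1))"
    by (simp add: Sum_Ico_nat algebra_simps)
  finally have "2 * \<rho> = r * (m * r - 1)"
    using \<open>0 < m\<close> by simp
  then show ?thesis
    by (metis dvd_triv_left)
qed

lemma magic_rectangle_even:
  assumes "magic_rectangle (a * m) (b * m) (b * s) (a * s) A" and "odd (a + b)"
  shows "even s"
proof -
  define N where "N = a * m * (b * s)"
  have "even (b * s * (N - 1))"
    using magic_rectangle_row_sum[OF assms(1)] by (simp add: N_def)
  moreover have "even (a * s * (N - 1))"
    using magic_rectangle_row_sum[OF magic_rectangle_transpose[OF assms(1)]]
    by (simp add: N_def mult.commute mult.left_commute)
  ultimately have "even ((a + b) * s * (N - 1))"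
    by (simp add: distrib_right)
  \<comment> \<open>Positivity makes \<open>N - 1\<close> the true predecessor of the even number
    \<open>N\<close>, hence odd. As \<open>a + b\<close> is odd too, only \<open>s\<close> can
    supply the factor 2.\<close>
  moreover have "0 < N"
    using assms(1) by (auto simp: N_def magic_rectangle_def)
  moreover have "even N"
    using assms(2) by (auto simp: N_def)
  ultimately show ?thesis
    using assms(2) by auto
qed

section \<open>The block diagonal construction\<close>

text \<open>The residue of \<open>i - j\<close> modulo \<open>m\<close> numbers the cyclic diagonal
  through block row \<open>i\<close> and block column \<open>j\<close>; adding \<open>m\<close>
  first keeps the subtraction exact for \<open>j < m\<close>.\<close>

definition diag_of :: "nat \<Rightarrow> nat \<Rightarrow> nat \<Rightarrow> nat" where
  "diag_of m i j = (i + m - j) mod m"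

lemma diag_of_less: "0 < m \<Longrightarrow> diag_of m i j < m"
  by (simp add: diag_of_def)

lemma diag_of_eq:
  assumes "i < m" "j < m"
  shows "diag_of m i j = (if j \<le> i then i - j else i + m - j)"
  using assms by (auto simp: diag_of_def le_mod_geq)

text \<open>Since \<open>i - (i - j) = j\<close>, diagonal \<open>d\<close> meets block row
  \<open>i\<close> in block column \<open>diag_of m i d\<close>.\<close>

lemma diag_of_involution:
  assumes "i < m" "j < m"
  shows "diag_of m i (diag_of m i j) = j"
  using assms diag_of_less[of m i j] by (auto simp: diag_of_eq split: if_splits)

lemma diag_of_row:
  assumes "i < m" "j < m"
  shows "(j + diag_of m i j) mod m = i"
  using assms by (auto simp: diag_of_eq)

text \<open>Column counterpart: diagonal \<open>d\<close> meets block column \<open>j\<close> in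
  block row \<open>(j + d) mod m\<close>.\<close>

lemma diag_of_add:
  assumes "j < m" "d < m"
  shows "diag_of m ((j + d) mod m) j = d"
proof (cases "j + d < m")
  case True
  then show ?thesis
    using assms by (simp add: diag_of_eq)
next
  case False
  then have "(j + d) mod m = j + d - m"
    using assms by (simp add: le_mod_geq)
  then show ?thesis
    using assms False by (auto simp: diag_of_eq)
qed

lemma div_mod_block:
  fixes a m :: nat
  assumes "R < a * m"
  shows "R div a < m" and "R mod a < a"
proof -
  have "0 < a"
    using assms by (cases a) auto
  then show "R div a < m" and "R mod a < a"
    using assms by (simp_all add: less_mult_imp_div_less mult.commute)
qed

lemma block_less:
  fixes a m :: nat
  assumes "i < m" "p < a"
  shows "a * i + p < a * m"
proof -
  have "a * i + p < a * Suc i"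
    using assms by simp
  also have "\<dots> \<le> a * m"
    using assms by (intro mult_le_mono) auto
  finally show ?thesis .
qed

lemma sum_consecutive_pairs:
  fixes f :: "nat \<Rightarrow> nat"
  shows "(\<Sum>d<2 * h. f d) = (\<Sum>t<h. f (2 * t) + f (2 * t + 1))"
  by (induction h) auto

text \<open>In \<open>e (t, j, p, q)\<close>, \<open>t\<close> numbers the pair of diagonals,
  \<open>j\<close> the block column, and \<open>(p, q)\<close> the position inside the block. The
  constant \<open>2 * a * b * m * h\<close> is the number of filled cells.\<close>

definition block_array ::
  "nat \<Rightarrow> nat \<Rightarrow> nat \<Rightarrow> nat \<Rightarrow> (nat \<times> nat \<times> nat \<times> nat \<Rightarrow> nat) \<Rightarrow> nat \<Rightarrow> nat \<Rightarrow> nat option" where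
  "block_array a b m h e R C =
     (let d = diag_of m (R div a) (C div b); x = e (d div 2, C div b, R mod a, C mod b) in
      if d < 2 * h then Some (if even d then x else 2 * a * b * m * h - 1 - x) else None)"

text \<open>Coordinates (diagonal, position in the block) on the filled cells of a row; they serve
  both to count the cells and to reindex the row sum.\<close>

lemma block_array_row_cells:
  assumes "R < a * m" "2 * h \<le> m" "0 < b"
  shows "bij_betw (\<lambda>(d, q). b * diag_of m (R div a) d + q) ({..<2 * h} \<times> {..<b})
           (row_cells (b * m) (block_array a b m h e) R)"
proof (rule bij_betwI[where g = "\<lambda>C. (diag_of m (R div a) (C div b), C mod b)"])
  have R: "R div a < m" and m: "0 < m"
    using div_mod_block[OF assms(1)] by auto
  show "(\<lambda>(d, q). b * diag_of m (R div a) d + q)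
      \<in> {..<2 * h} \<times> {..<b} \<rightarrow> row_cells (b * m) (block_array a b m h e) R"
    using assms R m diag_of_involution[OF R]
    by (auto simp: row_cells_def block_array_def Let_def block_less diag_of_less)
  show "(\<lambda>C. (diag_of m (R div a) (C div b), C mod b))
      \<in> row_cells (b * m) (block_array a b m h e) R \<rightarrow> {..<2 * h} \<times> {..<b}"
    using assms by (auto simp: row_cells_def block_array_def Let_def split: if_splits)
  show "\<And>x. x \<in> {..<2 * h} \<times> {..<b} \<Longrightarrow>
      (diag_of m (R div a) ((case x of (d, q) \<Rightarrow> b * diag_of m (R div a) d + q) div b),
       (case x of (d, q) \<Rightarrow> b * diag_of m (R div a) d + q) mod b) = x"
    using assms R diag_of_involution[OF R] by auto
  show "\<And>C. C \<in> row_cells (b * m) (block_array a b m h e) R \<Longrightarrow>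
      (case (diag_of m (R div a) (C div b), C mod b) of (d, q) \<Rightarrow> b * diag_of m (R div a) d + q) = C"
    using R diag_of_involution[OF R] div_mod_block(1) by (auto simp: row_cells_def)
qed

lemma block_array_col_cells:
  assumes "C < b * m" "2 * h \<le> m" "0 < a"
  shows "bij_betw (\<lambda>(d, p). a * ((C div b + d) mod m) + p) ({..<2 * h} \<times> {..<a})
           (col_cells (a * m) (block_array a b m h e) C)"
proof (rule bij_betwI[where g = "\<lambda>R. (diag_of m (R div a) (C div b), R mod a)"])
  have C: "C div b < m" and m: "0 < m"
    using div_mod_block[OF assms(1)] by auto
  show "(\<lambda>(d, p). a * ((C div b + d) mod m) + p)
      \<in> {..<2 * h} \<times> {..<a} \<rightarrow> col_cells (a * m) (block_array a b m h e) C"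
    using assms C m diag_of_add[OF C]
    by (auto simp: col_cells_def block_array_def Let_def block_less)
  show "(\<lambda>R. (diag_of m (R div a) (C div b), R mod a))
      \<in> col_cells (a * m) (block_array a b m h e) C \<rightarrow> {..<2 * h} \<times> {..<a}"
    using assms by (auto simp: col_cells_def block_array_def Let_def split: if_splits)
  show "\<And>x. x \<in> {..<2 * h} \<times> {..<a} \<Longrightarrow>
      (diag_of m ((case x of (d, p) \<Rightarrow> a * ((C div b + d) mod m) + p) div a) (C div b),
       (case x of (d, p) \<Rightarrow> a * ((C div b + d) mod m) + p) mod a) = x"
    using assms C diag_of_add[OF C] by auto
  show "\<And>R. R \<in> col_cells (a * m) (block_array a b m h e) C \<Longrightarrow>
      (case (diag_of m (R div a) (C div b), R mod a) of
        (d, p) \<Rightarrow> a * ((C div b + d) mod m) + p) = R"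
    using C diag_of_row[OF _ C] div_mod_block(1) by (auto simp: col_cells_def)
qed

lemma magic_rectangle_block_array:
  fixes a b m h :: nat and e :: "nat \<times> nat \<times> nat \<times> nat \<Rightarrow> nat"
  defines "N \<equiv> 2 * a * b * m * h"
    and "B \<equiv> {..<h} \<times> {..<m} \<times> {..<a} \<times> {..<b}"
  assumes pos: "0 < a" "0 < b" "0 < h" and hm: "2 * h \<le> m"
    and inj: "inj_on e B"
    and less: "\<And>x. x \<in> B \<Longrightarrow> e x < N"
    and compl: "\<And>x y. x \<in> B \<Longrightarrow> y \<in> B \<Longrightarrow> e x + e y \<noteq> N - 1"
    and rows: "\<And>t j p. t < h \<Longrightarrow> j < m \<Longrightarrow> p < a \<Longrightarrow> (\<Sum>q<b. e (t, j, p, q)) = \<rho> t p"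
  shows "magic_rectangle (a * m) (b * m) (b * (2 * h)) (a * (2 * h)) (block_array a b m h e)"
proof -
  let ?A = "block_array a b m h e"
  have m: "0 < m"
    using pos hm by simp
  have row_card: "card (row_cells (b * m) ?A R) = b * (2 * h)" if "R < a * m" for R
    using bij_betw_same_card[OF block_array_row_cells[OF that hm pos(2), of e]]
    by (simp add: mult.commute)
  have col_card: "card (col_cells (a * m) ?A C) = a * (2 * h)" if "C < b * m" for C
    using bij_betw_same_card[OF block_array_col_cells[OF that hm pos(1), of e]]
    by (simp add: mult.commute)
  have row_sum: "(\<Sum>C\<in>row_cells (b * m) ?A R. the (?A R C)) = h * (b * (N - 1))"
    if "R < a * m" for R
  proof -
    define i p where "i = R div a" and "p = R mod a"
    have ip: "i < m" "p < a"
      using div_mod_block[OF that] by (auto simp: i_def p_def)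
    have "(\<Sum>C\<in>row_cells (b * m) ?A R. the (?A R C))
        = (\<Sum>(d, q)\<in>{..<2 * h} \<times> {..<b}. the (?A R (b * diag_of m i d + q)))"
      using sum.reindex_bij_betw[OF block_array_row_cells[OF that hm pos(2), of e],
          of "\<lambda>C. the (?A R C)"]
      by (simp add: case_prod_unfold i_def)
    also have "\<dots> = (\<Sum>d<2 * h. \<Sum>q<b. the (?A R (b * diag_of m i d + q)))"
      by (simp add: sum.cartesian_product)
    also have "\<dots> = (\<Sum>d<2 * h. \<Sum>q<b. if even d then e (d div 2, diag_of m i d, p, q)
        else N - 1 - e (d div 2, diag_of m i d, p, q))"
      using hm ip(1) diag_of_involution[OF ip(1)]
      by (intro sum.cong refl)
        (auto simp: block_array_def Let_def N_def i_def[symmetric] p_def[symmetric])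
    also have "\<dots> = (\<Sum>t<h. (\<Sum>q<b. e (t, diag_of m i (2 * t), p, q))
        + (\<Sum>q<b. N - 1 - e (t, diag_of m i (2 * t + 1), p, q)))"
      by (simp add: sum_consecutive_pairs)
    also have "\<dots> = (\<Sum>t<h. b * (N - 1))"
    proof (intro sum.cong refl)
      fix t assume "t \<in> {..<h}"
      then have t: "t < h"
        by simp
      \<comment> \<open>Within a row, the two diagonals of a pair lie in different block columns.
        The hypothesis \<open>rows\<close> moves the first sum to the block column of the
        complement, where the entries then cancel in pairs.\<close>
      have "(\<Sum>q<b. e (t, diag_of m i (2 * t), p, q))
          = (\<Sum>q<b. e (t, diag_of m i (2 * t + 1), p, q))"
        using t ip m by (simp add: rows diag_of_less)
      moreover have "(\<Sum>q<b. e (t, diag_of m i (2 * t + 1), p, q))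
          + (\<Sum>q<b. N - 1 - e (t, diag_of m i (2 * t + 1), p, q)) = (\<Sum>q<b. N - 1)"
        unfolding sum.distrib[symmetric]
      proof (intro sum.cong refl)
        fix q assume "q \<in> {..<b}"
        then have "e (t, diag_of m i (2 * t + 1), p, q) < N"
          using t ip m by (intro less) (simp add: B_def diag_of_less)
        then show "e (t, diag_of m i (2 * t + 1), p, q)
            + (N - 1 - e (t, diag_of m i (2 * t + 1), p, q)) = N - 1"
          by simp
      qed
      ultimately show "(\<Sum>q<b. e (t, diag_of m i (2 * t), p, q))
          + (\<Sum>q<b. N - 1 - e (t, diag_of m i (2 * t + 1), p, q)) = b * (N - 1)"
        by simp
    qed
    finally show ?thesis
      by simp
  qed
  have col_sum: "(\<Sum>R\<in>col_cells (a * m) ?A C. the (?A R C)) = h * (a * (N - 1))"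
    if "C < b * m" for C
  proof -
    define j q where "j = C div b" and "q = C mod b"
    have jq: "j < m" "q < b"
      using div_mod_block[OF that] by (auto simp: j_def q_def)
    have "(\<Sum>R\<in>col_cells (a * m) ?A C. the (?A R C))
        = (\<Sum>(d, p)\<in>{..<2 * h} \<times> {..<a}. the (?A (a * ((j + d) mod m) + p) C))"
      using sum.reindex_bij_betw[OF block_array_col_cells[OF that hm pos(1), of e],
          of "\<lambda>R. the (?A R C)"]
      by (simp add: case_prod_unfold j_def)
    also have "\<dots> = (\<Sum>d<2 * h. \<Sum>p<a. the (?A (a * ((j + d) mod m) + p) C))"
      by (simp add: sum.cartesian_product)
    also have "\<dots> = (\<Sum>d<2 * h. \<Sum>p<a. if even d then e (d div 2, j, p, q)
        else N - 1 - e (d div 2, j, p, q))"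
      using hm diag_of_add[OF jq(1)]
      by (intro sum.cong refl)
        (auto simp: block_array_def Let_def N_def j_def[symmetric] q_def[symmetric])
    \<comment> \<open>Within a column both diagonals of a pair share \<open>j\<close>, so each entry
      meets its own complement.\<close>
    also have "\<dots> = (\<Sum>t<h. \<Sum>p<a. e (t, j, p, q) + (N - 1 - e (t, j, p, q)))"
      by (simp add: sum_consecutive_pairs sum.distrib)
    also have "\<dots> = (\<Sum>t<h. \<Sum>p<a. N - 1)"
    proof (intro sum.cong refl)
      fix t p assume "t \<in> {..<h}" "p \<in> {..<a}"
      then have "e (t, j, p, q) < N"
        using jq by (intro less) (simp add: B_def)
      then show "e (t, j, p, q) + (N - 1 - e (t, j, p, q)) = N - 1"
        by simp
    qed
    finally show ?thesis
      by simp
  qed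
  have cell: "\<exists>x d. x \<in> B \<and> d < m \<and> x = (d div 2, C div b, R mod a, C mod b)
      \<and> d = diag_of m (R div a) (C div b) \<and> the (?A R C) = (if even d then e x else N - 1 - e x)"
    if "(R, C) \<in> filled_cells (a * m) (b * m) ?A" for R C
    using that pos hm m div_mod_block[of R a m] div_mod_block[of C b m]
    by (auto simp: filled_cells_def block_array_def Let_def B_def N_def diag_of_less
        split: if_splits)
  have "inj_on (\<lambda>(R, C). the (?A R C)) (filled_cells (a * m) (b * m) ?A)"
  proof (rule inj_onI, clarify)
    fix R C R' C'
    assume RC: "(R, C) \<in> filled_cells (a * m) (b * m) ?A"
      and RC': "(R', C') \<in> filled_cells (a * m) (b * m) ?A"
      and eq: "the (?A R C) = the (?A R' C')"
    obtain x d where x: "x \<in> B" "x = (d div 2, C div b, R mod a, C mod b)"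
      "d = diag_of m (R div a) (C div b)" "the (?A R C) = (if even d then e x else N - 1 - e x)"
      using cell[OF RC] by blast
    obtain x' d' where x': "x' \<in> B" "x' = (d' div 2, C' div b, R' mod a, C' mod b)"
      "d' = diag_of m (R' div a) (C' div b)"
      "the (?A R' C') = (if even d' then e x' else N - 1 - e x')"
      using cell[OF RC'] by blast
    \<comment> \<open>Equal entries on diagonals of different parity would give
      \<open>e x + e x' = N - 1\<close>, which \<open>compl\<close> excludes.\<close>
    have parity: "even d \<longleftrightarrow> even d'"
      using eq x(4) x'(4) compl[OF x(1) x'(1)] less[OF x(1)] less[OF x'(1)]
      by (auto split: if_splits)
    then have "e x = e x'"
      using eq x(4) x'(4) less[OF x(1)] less[OF x'(1)] by (auto split: if_splits)
    then have "x = x'"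
      using inj x(1) x'(1) by (auto dest: inj_onD)
    then have same: "d div 2 = d' div 2" "C div b = C' div b" "R mod a = R' mod a"
      "C mod b = C' mod b"
      using x(2) x'(2) by auto
    have "d = d'"
      using same(1) parity by (metis dvd_mult_div_cancel odd_two_times_div_two_succ)
    moreover have "R div a < m" "R' div a < m" "C div b < m"
      using RC RC' div_mod_block(1) by (auto simp: filled_cells_def)
    ultimately have "R div a = R' div a"
      using x(3) x'(3) same(2) by (metis diag_of_row)
    then show "R = R' \<and> C = C'"
      using same(2-4) by (metis mult_div_mod_eq)
  qed
  moreover have "(\<lambda>(R, C). the (?A R C)) ` filled_cells (a * m) (b * m) ?A \<subseteq> {0..<N}"
  proof clarsimp
    fix R C
    assume "(R, C) \<in> filled_cells (a * m) (b * m) ?A"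
    from cell[OF this] less show "the (?A R C) < N"
      by (fastforce split: if_splits)
  qed
  \<comment> \<open>Distinct values below \<open>N\<close> in exactly \<open>N\<close> cells must
    exhaust \<open>{0..<N}\<close>.\<close>
  moreover have "card (filled_cells (a * m) (b * m) ?A) = N"
    using row_card by (simp add: filled_cells_Sigma card_SigmaI N_def)
  ultimately have "bij_betw (\<lambda>(R, C). the (?A R C)) (filled_cells (a * m) (b * m) ?A) {0..<N}"
    by (simp add: bij_betw_def card_subset_eq card_image)
  moreover have "a * m * (b * (2 * h)) = N"
    by (simp add: N_def)
  ultimately show ?thesis
    unfolding magic_rectangle_def using row_card col_card row_sum col_sum pos hm m
    by (auto simp: mult.commute mult.left_commute)
qed

text \<open>The entries are \<open>v\<close> or \<open>N - 1 - v\<close> for distinct numbers \<open>v\<close> below \<open>N div 2\<close>, so no entry and no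
  sum of two entries interferes with the complements.\<close>

lemma magic_rectangle_signed_block_array:
  fixes a b m h :: nat and v :: "nat \<Rightarrow> nat \<Rightarrow> nat \<Rightarrow> nat \<Rightarrow> nat" and pos_sign :: "nat \<Rightarrow> bool"
  defines "N \<equiv> 2 * a * b * m * h"
    and "B \<equiv> {..<h} \<times> {..<m} \<times> {..<a} \<times> {..<b}"
  assumes pos: "0 < a" "0 < b" "0 < h" and hm: "2 * h \<le> m"
    and inj: "inj_on (\<lambda>(t, j, p, q). v t j p q) B"
    and less: "\<And>t j p q. t < h \<Longrightarrow> j < m \<Longrightarrow> p < a \<Longrightarrow> q < b \<Longrightarrow> v t j p q < a * b * m * h"
    and rows: "\<And>t j p. t < h \<Longrightarrow> j < m \<Longrightarrow> p < a \<Longrightarrow>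
      (\<Sum>q<b. if pos_sign q then v t j p q else N - 1 - v t j p q) = \<rho> t p"
  shows "\<exists>A. magic_rectangle (a * m) (b * m) (b * (2 * h)) (a * (2 * h)) A"
proof -
  define w where "w = (\<lambda>(t, j, p, q). v t j p q)"
  define e where "e = (\<lambda>(t, j, p, q). if pos_sign q then v t j p q else N - 1 - v t j p q)"
  define M where "M = a * b * m * h"
  have M: "N = 2 * M" "\<And>x. x \<in> B \<Longrightarrow> w x < M"
    using less by (auto simp: N_def M_def B_def w_def)
  have e: "e x = w x \<and> pos_sign (snd (snd (snd x)))
      \<or> e x = N - 1 - w x \<and> \<not> pos_sign (snd (snd (snd x)))" for x
    by (auto simp: e_def w_def split: prod.splits)
  have "inj_on e B"
  proof (rule inj_onI)
    fix x y assume xy: "x \<in> B" "y \<in> B" "e x = e y"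
    \<comment> \<open>Plain values lie below \<open>M\<close> and reflected ones are at least
      \<open>M\<close>, so equal entries are of the same kind.\<close>
    then have "w x = w y"
      using e[of x] e[of y] M(2)[OF xy(1)] M(2)[OF xy(2)] M(1) by auto
    then show "x = y"
      using inj[folded w_def] xy by (auto dest: inj_onD)
  qed
  moreover have "e x < N" if "x \<in> B" for x
    using e[of x] M(2)[OF that] M(1) by auto
  moreover have "e x + e y \<noteq> N - 1" if xy: "x \<in> B" "y \<in> B" for x y
  proof
    assume sum: "e x + e y = N - 1"
    \<comment> \<open>Two plain values add up to at most \<open>2 * M - 2\<close> and two reflected
      ones to at least \<open>2 * M\<close>. The sum \<open>2 * M - 1\<close> therefore needs one of
      each, with the same underlying number.\<close>
    then have "w x = w y" "pos_sign (snd (snd (snd x))) \<noteq> pos_sign (snd (snd (snd y)))"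
      using e[of x] e[of y] M(2)[OF xy(1)] M(2)[OF xy(2)] M(1) by auto
    then show False
      using inj[folded w_def] xy by (auto dest: inj_onD)
  qed
  moreover have "(\<Sum>q<b. e (t, j, p, q)) = \<rho> t p" if "t < h" "j < m" "p < a" for t j p
    using rows[OF that] by (simp add: e_def)
  ultimately show ?thesis
    using magic_rectangle_block_array[of a b h m e \<rho>] pos hm
    unfolding N_def B_def by blast
qed

section \<open>Explicit blocks\<close>

lemma mult_add_inj:
  fixes k u u' x x' :: nat
  assumes "k * u + x = k * u' + x'" "x < k" "x' < k"
  shows "u = u'" and "x = x'"
proof -
  have "(k * u + x) div k = (k * u' + x') div k"
    using assms(1) by simp
  then show "u = u'"
    using assms(2,3) by simp
  then show "x = x'"
    using assms(1) by simp
qed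

text \<open>Each block holds four consecutive numbers with signs \<open>+ - - +\<close>. Since
  \<open>0 - 1 - 2 + 3 = 0\<close>, only the two reflection constants \<open>N - 1\<close> remain in
  the row sum.\<close>

lemma magic_rectangle_1_4:
  assumes "0 < h" "2 * h \<le> m"
  shows "\<exists>A. magic_rectangle (1 * m) (4 * m) (4 * (2 * h)) (1 * (2 * h)) A"
proof (rule magic_rectangle_signed_block_array[where
      v = "\<lambda>t j p q. 4 * (m * t + j) + q" and pos_sign = "\<lambda>q. q = 0 \<or> q = 3" and
      \<rho> = "\<lambda>t p. 2 * (2 * 1 * 4 * m * h - 1)"])
  have bound: "4 * (m * t + j) + q < 4 * (m * h)" if "t < h" "j < m" "q < 4" for t j q
    using block_less[OF block_less[OF that(1,2)] that(3)] .
  show "inj_on (\<lambda>(t, j, p, q). 4 * (m * t + j) + q) ({..<h} \<times> {..<m} \<times> {..<1::nat} \<times> {..<4})"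
  proof (rule inj_onI,
      unfold split_paired_all prod.case mem_Sigma_iff prod.inject, elim conjE)
    fix t j p q t' j' p' q' :: nat
    assume eq: "4 * (m * t + j) + q = 4 * (m * t' + j') + q'"
      and *: "j \<in> {..<m}" "p \<in> {..<1}" "q \<in> {..<4}" "j' \<in> {..<m}" "p' \<in> {..<1}" "q' \<in> {..<4}"
    have "m * t + j = m * t' + j'" "q = q'"
      using mult_add_inj[OF eq] * by auto
    then show "t = t' \<and> j = j' \<and> p = p' \<and> q = q'"
      using mult_add_inj[of m t j t' j'] * by auto
  qed
  show "4 * (m * t + j) + q < 1 * 4 * m * h" if "t < h" "j < m" "p < 1" "q < 4" for t j p q :: nat
    using bound[OF that(1,2,4)] by simp
  show "(\<Sum>q<4. if q = 0 \<or> q = 3 then 4 * (m * t + j) + q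
        else 2 * 1 * 4 * m * h - 1 - (4 * (m * t + j) + q))
      = 2 * (2 * 1 * 4 * m * h - 1)"
    if "t < h" "j < m" "p < 1" for t j p :: nat
  proof -
    define u n where "u = m * t + j" and "n = m * h"
    have "4 * u + 3 < 4 * n"
      using bound[OF that(1,2), of 3] by (simp add: u_def n_def)
    \<comment> \<open>Together with the preceding bound this shows that no reflection is truncated
      at 0.\<close>
    moreover have "2 * 1 * 4 * m * h = 8 * n"
      by (simp add: n_def)
    ultimately show ?thesis
      unfolding u_def[symmetric] by (simp add: eval_nat_numeral lessThan_Suc)
  qed
qed (use assms in auto)

text \<open>The numbers below \<open>6 m\<close> are split into three intervals of length \<open>2 m\<close>. Row \<open>p\<close> of block \<open>j\<close>
  gets a pair of distance \<open>2 j + 1\<close>, symmetric about the centre of interval \<open>p + 1\<close>, and the number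
  \<open>2 j + p\<close> of interval \<open>0\<close> to make up for that distance.\<close>

definition block23 :: "nat \<Rightarrow> nat \<Rightarrow> nat \<Rightarrow> nat \<Rightarrow> nat" where
  "block23 m j p q = (if q = 0 then 2 * j + p
     else if q = 1 then 2 * m * (p + 1) + (m - 1 - j) else 2 * m * (p + 1) + (m + j))"

lemma block23_less:
  assumes "j < m" "p < 2"
  shows "block23 m j p q < 6 * m"
proof -
  from assms consider "p = 0" | "p = 1"
    by linarith
  then show ?thesis
    by cases (use assms in \<open>auto simp: block23_def\<close>)
qed

text \<open>Column 0 uses the numbers below \<open>2 * m\<close>, with \<open>p\<close> as the
  parity. Columns 1 and 2 use the lower and upper halves of interval \<open>p + 1\<close>, because
  \<open>m - 1 - j < m \<le> m + j\<close>.\<close>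

lemma block23_inj:
  assumes "block23 m j p q = block23 m j' p' q'"
    and "j < m" "p < 2" "q < 3" "j' < m" "p' < 2" "q' < 3"
  shows "j = j' \<and> p = p' \<and> q = q'"
proof -
  have p: "p = 0 \<or> p = 1" "p' = 0 \<or> p' = 1" and q: "q = 0 \<or> q = 1 \<or> q = 2" "q' = 0 \<or> q' = 1 \<or> q' = 2"
    using assms by linarith+
  show ?thesis
    using p q assms(1,2,5) unfolding block23_def
    by (elim disjE) (simp_all, presburger+)
qed

text \<open>The pairs \<open>t\<close> use copies of \<open>block23\<close> shifted by
  \<open>6 * m * t\<close>, with signs \<open>+ + -\<close>. In a row,
  \<open>(2 * j + p) + (m - 1 - j) - (m + j) = p - 1\<close> is free of \<open>j\<close>; the shift
  and the constant \<open>N - 1\<close> complete \<open>\<rho>\<close>.\<close>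

lemma magic_rectangle_2_3:
  assumes "0 < h" "2 * h \<le> m"
  shows "\<exists>A. magic_rectangle (2 * m) (3 * m) (3 * (2 * h)) (2 * (2 * h)) A"
proof (rule magic_rectangle_signed_block_array[where
      v = "\<lambda>t j p q. 6 * m * t + block23 m j p q" and pos_sign = "\<lambda>q. q < 2" and
      \<rho> = "\<lambda>t p. 6 * m * t + p + (2 * 2 * 3 * m * h - 2)"])
  have bound: "6 * m * t + block23 m j p q < 6 * m * h" if "t < h" "j < m" "p < 2" for t j p q
    using block_less[OF that(1) block23_less[OF that(2,3)]] .
  show "inj_on (\<lambda>(t, j, p, q). 6 * m * t + block23 m j p q)
      ({..<h} \<times> {..<m} \<times> {..<2} \<times> {..<3})"
  proof (rule inj_onI,
      unfold split_paired_all prod.case mem_Sigma_iff prod.inject, elim conjE)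
    fix t j p q t' j' p' q' :: nat
    assume eq: "6 * m * t + block23 m j p q = 6 * m * t' + block23 m j' p' q'"
      and *: "j \<in> {..<m}" "p \<in> {..<2}" "q \<in> {..<3}" "j' \<in> {..<m}" "p' \<in> {..<2}" "q' \<in> {..<3}"
    show "t = t' \<and> j = j' \<and> p = p' \<and> q = q'"
      using mult_add_inj[OF eq block23_less block23_less] block23_inj[of m j p q j' p' q'] * by auto
  qed
  show "6 * m * t + block23 m j p q < 2 * 3 * m * h" if "t < h" "j < m" "p < 2" "q < 3" for t j p q
    using bound[OF that(1-3)] by simp
  show "(\<Sum>q<3. if q < 2 then 6 * m * t + block23 m j p q
        else 2 * 2 * 3 * m * h - 1 - (6 * m * t + block23 m j p q))
      = 6 * m * t + p + (2 * 2 * 3 * m * h - 2)"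
    if "t < h" "j < m" "p < 2" for t j p :: nat
  proof -
    define u n w where "u = 6 * m * t" and "n = 6 * m * h" and "w = 2 * m * (p + 1)"
    \<comment> \<open>This is the entry of column 2, the only reflected one, so its subtraction from
      \<open>2 * n - 1\<close> is exact.\<close>
    have "u + (w + (m + j)) < n"
      using bound[OF that, of 2] by (simp add: u_def n_def w_def block23_def)
    moreover have "2 * 2 * 3 * m * h = 2 * n"
      by (simp add: n_def)
    ultimately show ?thesis
      using that(2) unfolding u_def[symmetric] block23_def w_def[symmetric]
      by (simp add: eval_nat_numeral lessThan_Suc)
  qed
qed (use assms in auto)

theorem theorem12:
  fixes a b m s :: nat
  assumes "0 < a" and "0 < b" and "a + b = 5" and "0 < m" and "0 < s"
  shows "(\<exists>A. magic_rectangle (a * m) (b * m) (b * s) (a * s) A) \<longleftrightarrow> even s \<and> 2 \<le> s \<and> s \<le> m"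
proof
  assume "\<exists>A. magic_rectangle (a * m) (b * m) (b * s) (a * s) A"
  then obtain A where A: "magic_rectangle (a * m) (b * m) (b * s) (a * s) A" ..
  have "even s"
    using magic_rectangle_even[OF A] assms(3) by simp
  moreover have "s \<le> m"
    using A assms(1) by (simp add: magic_rectangle_def)
  ultimately show "even s \<and> 2 \<le> s \<and> s \<le> m"
    using assms(5) by (auto elim!: evenE)
next
  assume s: "even s \<and> 2 \<le> s \<and> s \<le> m"
  then obtain h where h: "s = 2 * h" "0 < h" "2 * h \<le> m"
    by (auto elim!: evenE)
  \<comment> \<open>The last two cases are the transposes of the second and the first.\<close>
  consider "a = 1" "b = 4" | "a = 2" "b = 3" | "a = 3" "b = 2" | "a = 4" "b = 1"
    using assms(1-3) by linarith
  then show "\<exists>A. magic_rectangle (a * m) (b * m) (b * s) (a * s) A"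
    using magic_rectangle_1_4[OF h(2,3)] magic_rectangle_2_3[OF h(2,3)] h(1)
    by cases (blast intro: magic_rectangle_transpose)+
qed

end
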